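(* Let $n\ge 4$, let $\phi:Q_n\to Q_n$ be an automorphism, and let $\psi=\phi\upharpoonright_{Q_{n-1}}$ be its restriction to $Q_{n-1}$, where $Q_{n-1}$ is identified with the subloop $\{(x,0)\mid x\in Q_{n-1}\}$ of $Q_n$. Let $e=(1_{Q_{n-1}},1)\in Q_n$. Then 1. $\phi(1)=1$ and $\phi(-1)=-1$; 2. $\phi(e)=e$ or $\phi(e)=-e$; 3. $\psi\in \mathrm{Aut}(Q_{n-1})$ (in particular $\phi$ maps $Q_{n-1}$ to itself); 4. $\phi((x,1))=\psi(x)\phi(e)$ for all $x\in Q_{n-1}$.
   Context: Cayley-Dickson loops $Q_n$ are defined inductively, each with a negation $x\mapsto -x$ and a conjugation $x\mapsto x^*$. $Q_0=\{1,-1\}$ with the usual multiplication and $x^*=x$. For $n\ge 1$, $Q_n=\{(x,0),(x,1)\mid x\in Q_{n-1}\}$ with $-(x,a)=(-x,a)$, multiplication $(x,0)(y,0)=(xy,0)$, $(x,0)(y,1)=(yx,1)$, $(x,1)(y,0)=(xy^*,1)$, $(x,1)(y,1)=(-y^*x,0)$, and conjugation $(x,0)^*=(x^*,0)$, $(x,1)^*=(-x,1)$. The neutral element of $Q_n$ is $1=(1_{Q_{n-1}},0)$, and $-1$ denotes its negative. $Q_{n-1}$ is regarded as a subloop of $Q_n$ via $x\mapsto (x,0)$. An automorphism of a loop is a bijective homomorphism from the loop to itself; $\mathrm{Aut}(L)$ is the group of automorphisms of $L$ under composition. *)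

theory Defs
  imports "HOL-Algebra.Bij"
begin

text \<open>
  Elements of all Cayley-Dickson loops live in one datatype: \<open>Base 1\<close> and \<open>Base (-1)\<close> form \<open>Q\<^sub>0\<close>, and
  \<open>Ext x a\<close> is the pair \<open>(x, a)\<close>, with \<open>False\<close> for \<open>0\<close> and \<open>True\<close> for \<open>1\<close>. The elements of \<open>Q\<^sub>n\<close> are
  those with exactly \<open>n\<close> levels of \<open>Ext\<close>.
\<close>

datatype cd = Base int | Ext cd bool

primrec cd_set :: "nat \<Rightarrow> cd set" where
  "cd_set 0 = {Base 1, Base (-1)}"
| "cd_set (Suc n) = {Ext x a | x a. x \<in> cd_set n}"

primrec cd_one :: "nat \<Rightarrow> cd" where
  "cd_one 0 = Base 1"
| "cd_one (Suc n) = Ext (cd_one n) False"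

primrec cd_neg :: "cd \<Rightarrow> cd" where
  "cd_neg (Base k) = Base (- k)"
| "cd_neg (Ext x a) = Ext (cd_neg x) a"

fun cd_conj :: "cd \<Rightarrow> cd" where
  "cd_conj (Base k) = Base k"
| "cd_conj (Ext x False) = Ext (cd_conj x) False"
| "cd_conj (Ext x True) = Ext (cd_neg x) True"

lemma size_cd_neg [simp]: "size (cd_neg x) = size x"
  by (induction x) auto

lemma size_cd_conj [simp]: "size (cd_conj x) = size x"
  by (induction x rule: cd_conj.induct) auto

text \<open>Products of elements of different levels are left unspecified.\<close>

function (sequential) cd_mult :: "cd \<Rightarrow> cd \<Rightarrow> cd" where
  "cd_mult (Base k) (Base l) = Base (k * l)"
| "cd_mult (Ext x False) (Ext y False) = Ext (cd_mult x y) False"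
| "cd_mult (Ext x False) (Ext y True) = Ext (cd_mult y x) True"
| "cd_mult (Ext x True) (Ext y False) = Ext (cd_mult x (cd_conj y)) True"
| "cd_mult (Ext x True) (Ext y True) = Ext (cd_neg (cd_mult (cd_conj y) x)) False"
| "cd_mult _ _ = undefined"
  by pat_completeness auto
termination
  by (relation "Wellfounded.measure (\<lambda>(x, y). size x + size y)") auto

text \<open>
  The record type \<open>monoid\<close> only packages carrier, multiplication and neutral element; no associativity
  is implied, and the library notions \<open>hom\<close> and \<open>auto\<close> do not presuppose it.
  Elements of \<open>auto G\<close> are, by the library's convention, \<open>undefined\<close> outside \<open>carrier G\<close>.
\<close>

definition Q :: "nat \<Rightarrow> cd monoid" where
  "Q n = \<lparr>carrier = cd_set n, monoid.mult = cd_mult, one = cd_one n\<rparr>"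

text \<open>The copy \<open>{(x, 0) | x \<in> Q\<^sub>m}\<close> of \<open>Q\<^sub>m\<close> as a subloop of \<open>Q\<^sub>m\<^sub>+\<^sub>1\<close>.\<close>

definition Q_sub :: "nat \<Rightarrow> cd monoid" where
  "Q_sub m = (Q (Suc m))\<lparr>carrier := (\<lambda>x. Ext x False) ` carrier (Q m)\<rparr>"

lemma cd_neg_in_cd_set: "x \<in> cd_set n \<Longrightarrow> cd_neg x \<in> cd_set n"
  by (induction n arbitrary: x) auto

lemma cd_conj_in_cd_set: "x \<in> cd_set n \<Longrightarrow> cd_conj x \<in> cd_set n"
proof (induction n arbitrary: x)
  case (Suc n)
  then obtain y a where "x = Ext y a" "y \<in> cd_set n" by auto
  with Suc.IH show ?case by (cases a) (auto simp: cd_neg_in_cd_set)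
qed auto

lemma cd_mult_in_cd_set: "x \<in> cd_set n \<Longrightarrow> y \<in> cd_set n \<Longrightarrow> cd_mult x y \<in> cd_set n"
proof (induction n arbitrary: x y)
  case (Suc n)
  then obtain u a v b where "x = Ext u a" "u \<in> cd_set n" "y = Ext v b" "v \<in> cd_set n" by auto
  with Suc.IH show ?case
    by (cases a; cases b) (auto simp: cd_neg_in_cd_set cd_conj_in_cd_set)
qed auto

lemma Ext_False_iso: "(\<lambda>x. Ext x False) \<in> iso (Q m) (Q_sub m)"
  by (auto simp: iso_def hom_def Q_def Q_sub_def bij_betw_def inj_on_def cd_mult_in_cd_set)

end

theory Submission
  imports Defs
begin

text \<open>
  Modulo \<open>\<plusminus>1\<close> the loop \<open>Q\<^sub>n\<close> is the elementary abelian 2-group of rank \<open>n\<close>, so its structure is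
  carried by signs: whether two elements commute, and whether three elements associate. Write
  \<open>n = m + 1\<close>, so \<open>m \<ge> 3\<close>, and let \<open>e = (1, 1)\<close>. Associativity interacts with doubling by two rules.

  \<^item> If \<open>u, v, w\<close> in \<open>Q\<^sub>m\<close> are independent modulo \<open>\<plusminus>1\<close>, then the sign of the associator of
    \<open>(u, i), (v, j), (w, k)\<close> is the sign for \<open>u, v, w\<close> times \<open>(-1)\<close> to the power \<open>i + k\<close>
    (\<open>assoc_Ext_iff\<close>).

  \<^item> A triple with \<open>\<plusminus>e\<close> as last or middle entry associates exactly when the first components of
    the other two entries commute (\<open>assoc_scalar_right_iff\<close>, \<open>assoc_scalar_middle_iff\<close>).

  Hence \<open>e\<close>, as last entry, associates with no pair that is independent from it. Every
  \<open>a = (b, d)\<close> with \<open>b \<noteq> \<plusminus>1\<close> does associate with such a pair: since \<open>m \<ge> 3\<close>, some \<open>u, v\<close> in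
  \<open>Q\<^sub>m\<close> are independent from \<open>b\<close> and do not associate with it, and by the first rule giving \<open>u\<close> a
  second component different from \<open>d\<close> flips the sign. This singles out \<open>\<plusminus>e\<close> by a property that an
  automorphism \<open>\<phi>\<close> preserves, so \<open>\<phi>(e) = \<plusminus>e\<close> (\<open>map_unit\<close>).

  What remains is that the second component \<open>\<chi>(x)\<close> of \<open>\<phi>(x, 0)\<close> is always \<open>0\<close>
  (\<open>\<chi>_trivial\<close>); with \<open>(x, 1) = (x, 0) e\<close> this gives the claims about the restriction of \<open>\<phi>\<close>.
  Let \<open>e'\<close> be the element \<open>(1, 1)\<close> of \<open>Q\<^sub>m\<close> and \<open>F\<close> the preimage of \<open>(e', 0)\<close>, with first component \<open>f\<close>. As \<open>e'\<close>
  in the middle never associates with independent elements, the first rule says that a triple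
  \<open>X, (e', 0), Y\<close> with independent first components associates if and only if \<open>X\<close> and \<open>Y\<close> have different second components.
  Pulled back along \<open>\<phi>\<close>: if \<open>x, f, y\<close> are independent and do not associate, then
  \<open>\<chi>(x) = \<chi>(y)\<close> (\<open>exists_middle_witness\<close>). There are so many such pairs \<open>x, y\<close>
  that the homomorphism \<open>\<chi>\<close> to the group with two elements has to be trivial.
\<close>

section \<open>Signs, conjugation and neutral element\<close>

notation cd_mult (infixl "\<odot>" 70)

definition scalar :: "nat \<Rightarrow> cd \<Rightarrow> bool" where
  "scalar n x \<longleftrightarrow> x = cd_one n \<or> x = cd_neg (cd_one n)"

lemma cd_neg_neg [simp]: "cd_neg (cd_neg x) = x"
  by (induction x) auto

lemma cd_neg_eq_iff [simp]: "cd_neg x = cd_neg y \<longleftrightarrow> x = y"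
  by (metis cd_neg_neg)

lemma cd_one_in_cd_set [simp]: "cd_one n \<in> cd_set n"
  by (induction n) auto

declare cd_neg_in_cd_set [simp] cd_conj_in_cd_set [simp] cd_mult_in_cd_set [simp]

lemma cd_neg_neq: "x \<in> cd_set n \<Longrightarrow> cd_neg x \<noteq> x"
  by (induction n arbitrary: x) auto

lemma finite_cd_set: "finite (cd_set n)"
proof (induction n)
  case (Suc n)
  have "cd_set (Suc n) = (\<lambda>(x, a). Ext x a) ` (cd_set n \<times> UNIV)"
    by auto
  with Suc show ?case by simp
qed simp

lemma cd_set_SucE:
  assumes "x \<in> cd_set (Suc n)"
  obtains u where "x = Ext u False" "u \<in> cd_set n" | u where "x = Ext u True" "u \<in> cd_set n"
proof -
  from assms obtain u a where "x = Ext u a" "u \<in> cd_set n" by auto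
  then show thesis using that by (cases a) auto
qed

lemma cd_conj_neg [simp]: "cd_conj (cd_neg x) = cd_neg (cd_conj x)"
  by (induction x rule: cd_conj.induct) auto

lemma cd_conj_conj [simp]: "cd_conj (cd_conj x) = x"
  by (induction x rule: cd_conj.induct) auto

lemma cd_mult_neg:
  assumes "x \<in> cd_set n" "y \<in> cd_set n"
  shows "cd_neg x \<odot> y = cd_neg (x \<odot> y)" "x \<odot> cd_neg y = cd_neg (x \<odot> y)"
  using assms
proof (induction n arbitrary: x y)
  case (Suc n)
  {
    case 1
    with Suc.IH show ?case by (elim cd_set_SucE) auto
  next
    case 2
    with Suc.IH show ?case by (elim cd_set_SucE) auto
  }
qed auto

lemma cd_conj_one [simp]: "cd_conj (cd_one n) = cd_one n"
  by (induction n) auto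

lemma cd_mult_one:
  assumes "x \<in> cd_set n"
  shows "cd_one n \<odot> x = x" "x \<odot> cd_one n = x"
  using assms
proof (induction n arbitrary: x)
  case (Suc n)
  {
    case 1
    with Suc.IH show ?case by (elim cd_set_SucE) auto
  next
    case 2
    with Suc.IH show ?case by (elim cd_set_SucE) auto
  }
qed auto

lemma cd_conj_mult:
  "x \<in> cd_set n \<Longrightarrow> y \<in> cd_set n \<Longrightarrow> cd_conj (x \<odot> y) = cd_conj y \<odot> cd_conj x"
proof (induction n arbitrary: x y)
  case (Suc n)
  from Suc.prems show ?case
    by (elim cd_set_SucE) (auto simp: Suc.IH cd_mult_neg[of _ n])
qed auto

lemma scalar_conj: "scalar n x \<Longrightarrow> cd_conj x = x"
  by (auto simp: scalar_def)

lemma nonscalar_conj: "x \<in> cd_set n \<Longrightarrow> \<not> scalar n x \<Longrightarrow> cd_conj x = cd_neg x"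
proof (induction n arbitrary: x)
  case (Suc n)
  then show ?case by (elim cd_set_SucE) (auto simp: scalar_def)
qed (auto simp: scalar_def)

lemma scalar_mult:
  assumes "scalar n c" "x \<in> cd_set n"
  shows "c \<odot> x = x \<and> x \<odot> c = x \<or> c \<odot> x = cd_neg x \<and> x \<odot> c = cd_neg x"
  using assms by (auto simp: scalar_def cd_mult_one cd_mult_neg[of _ n])

lemma scalar_in_cd_set: "scalar n c \<Longrightarrow> c \<in> cd_set n"
  by (auto simp: scalar_def)

lemma scalar_neg [simp]: "scalar n (cd_neg x) \<longleftrightarrow> scalar n x"
  by (auto simp: scalar_def) (metis cd_neg_neg)+

lemma cd_square:
  assumes "x \<in> cd_set n"
  shows "x \<odot> x = (if scalar n x then cd_one n else cd_neg (cd_one n))"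
proof -
  have "cd_conj x \<odot> x = cd_one n"
    using assms
  proof (induction n arbitrary: x)
    case (Suc n)
    then show ?case by (elim cd_set_SucE) (auto simp: cd_mult_neg[of _ n])
  qed auto
  then show ?thesis
    using assms scalar_conj[of n x] nonscalar_conj[of x n]
    by (auto simp: cd_mult_neg[of _ n]) (metis cd_neg_neg)
qed

section \<open>The quotient by the signs\<close>

text \<open>
  The coordinates of the image in the elementary abelian 2-group \<open>Q\<^sub>n / {1, -1}\<close>, outermost level
  first and padded with \<open>False\<close>. A sequence instead of a list makes the group operation pointwise.
\<close>

primrec idx :: "cd \<Rightarrow> nat \<Rightarrow> bool" where
  "idx (Base k) = (\<lambda>i. False)"
| "idx (Ext x a) = case_nat a (idx x)"

lemma idx_neg [simp]: "idx (cd_neg x) = idx x"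
  by (induction x) auto

lemma idx_conj [simp]: "idx (cd_conj x) = idx x"
  by (induction x rule: cd_conj.induct) auto

lemma idx_mult:
  "x \<in> cd_set n \<Longrightarrow> y \<in> cd_set n \<Longrightarrow> idx (x \<odot> y) = (\<lambda>i. idx x i \<noteq> idx y i)"
proof (induction n arbitrary: x y)
  case (Suc n)
  from Suc.prems show ?case
    by (elim cd_set_SucE) (auto simp: Suc.IH fun_eq_iff split: nat.split)
qed auto

lemma idx_eq_iff:
  "x \<in> cd_set n \<Longrightarrow> y \<in> cd_set n \<Longrightarrow> idx x = idx y \<longleftrightarrow> x = y \<or> x = cd_neg y"
proof (induction n arbitrary: x y)
  case (Suc n)
  then obtain u a v b where *: "x = Ext u a" "u \<in> cd_set n" "y = Ext v b" "v \<in> cd_set n"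
    by auto
  have "idx x = idx y \<longleftrightarrow> a = b \<and> idx u = idx v"
    unfolding * by (auto simp: fun_eq_iff split: nat.split dest: spec[of _ 0] spec[of _ "Suc _"])
  then show ?case using * Suc.IH by auto
qed auto

lemma anticommute:
  assumes "x \<in> cd_set n" "y \<in> cd_set n" "x \<odot> y \<noteq> y \<odot> x"
  shows "y \<odot> x = cd_neg (x \<odot> y)"
proof -
  have "idx (y \<odot> x) = idx (x \<odot> y)"
    using assms by (auto simp: idx_mult[of _ n])
  then show ?thesis
    using idx_eq_iff[of "y \<odot> x" n "x \<odot> y"] assms by auto
qed

lemma assoc_up_to_sign:
  assumes "x \<in> cd_set n" "y \<in> cd_set n" "z \<in> cd_set n"
  shows "(x \<odot> y) \<odot> z = x \<odot> (y \<odot> z) \<or> (x \<odot> y) \<odot> z = cd_neg (x \<odot> (y \<odot> z))"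
proof -
  have "idx ((x \<odot> y) \<odot> z) = idx (x \<odot> (y \<odot> z))"
    using assms by (auto simp: idx_mult[of _ n])
  then show ?thesis
    using idx_eq_iff[of "(x \<odot> y) \<odot> z" n "x \<odot> (y \<odot> z)"] assms by auto
qed

text \<open>
  Linearly dependent images in the quotient are the only reason to commute. In the doubling step,
  \<open>(u, 0)\<close> and \<open>(v, 1)\<close> commute only if \<open>u\<close> equals its conjugate, so only if \<open>u\<close> is \<open>\<plusminus>1\<close>; this is
  why the mixed cases need no induction hypothesis.
\<close>

lemma commute_imp:
  "x \<in> cd_set n \<Longrightarrow> y \<in> cd_set n \<Longrightarrow> x \<odot> y = y \<odot> x \<Longrightarrow>
    scalar n x \<or> scalar n y \<or> x = y \<or> x = cd_neg y"
proof (induction n arbitrary: x y)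
  case (Suc n)
  have nn: "cd_neg (u \<odot> v) \<noteq> u \<odot> v" "u \<odot> v \<noteq> cd_neg (u \<odot> v)" if "u \<in> cd_set n" "v \<in> cd_set n" for u v
    using cd_neg_neq[of "u \<odot> v" n] that by auto
  have S: "scalar (Suc n) (Ext u False) = scalar n u" for u
    by (auto simp: scalar_def)
  from Suc.prems show ?case
  proof (elim cd_set_SucE)
    fix u v assume *: "x = Ext u False" "u \<in> cd_set n" "y = Ext v False" "v \<in> cd_set n"
    then show ?case using Suc.prems(3) Suc.IH[of u v] by (auto simp: S)
  next
    fix u v assume *: "x = Ext u False" "u \<in> cd_set n" "y = Ext v True" "v \<in> cd_set n"
    then show ?case using Suc.prems(3) nonscalar_conj[of u n] nn[of v u]
      by (cases "scalar n u") (auto simp: S cd_mult_neg[of _ n])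
  next
    fix u v assume *: "x = Ext u True" "u \<in> cd_set n" "y = Ext v False" "v \<in> cd_set n"
    then show ?case using Suc.prems(3) nonscalar_conj[of v n] nn[of u v]
      by (cases "scalar n v") (auto simp: S cd_mult_neg[of _ n])
  next
    fix u v assume *: "x = Ext u True" "u \<in> cd_set n" "y = Ext v True" "v \<in> cd_set n"
    then have eq: "cd_conj v \<odot> u = cd_conj u \<odot> v" using Suc.prems(3) by simp
    have "u = v \<or> u = cd_neg v"
    proof (cases "scalar n u \<or> scalar n v")
      case True
      have "scalar n u \<and> scalar n v"
        using True eq * nonscalar_conj[of u n] nonscalar_conj[of v n]
          scalar_mult[of n u v] scalar_mult[of n v u] scalar_conj[of n u] scalar_conj[of n v]
          cd_neg_neq[of u n] cd_neg_neq[of v n]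
        by (cases "scalar n u"; cases "scalar n v") (auto simp: cd_mult_neg[of _ n])
      then show ?thesis by (auto simp: scalar_def)
    next
      case False
      then have "u \<odot> v = v \<odot> u"
        using eq * nonscalar_conj[of u n] nonscalar_conj[of v n] by (auto simp: cd_mult_neg[of _ n])
      then show ?thesis using Suc.IH[of u v] * False by auto
    qed
    then show ?case using * by auto
  qed
qed auto

text \<open>
  The product is not \<open>\<plusminus>1\<close> because its conjugate is \<open>y \<odot> x\<close>, which differs from it.
\<close>

lemma noncommuting_nonscalar:
  assumes "x \<in> cd_set n" "y \<in> cd_set n" "x \<odot> y \<noteq> y \<odot> x"
  shows "\<not> scalar n x" "\<not> scalar n y" "\<not> scalar n (x \<odot> y)"
proof -
  show x: "\<not> scalar n x" and y: "\<not> scalar n y"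
    using scalar_mult assms by metis+
  have "cd_conj (x \<odot> y) = y \<odot> x"
    using assms x y by (simp add: cd_conj_mult[of _ n] nonscalar_conj[of _ n] cd_mult_neg[of _ n])
  then show "\<not> scalar n (x \<odot> y)"
    using assms(3) scalar_conj by metis
qed

lemma noncommuting_conj:
  assumes "x \<in> cd_set n" "y \<in> cd_set n" "x \<odot> y \<noteq> y \<odot> x"
  shows "cd_conj x = cd_neg x" "cd_conj y = cd_neg y" "y \<odot> x = cd_neg (x \<odot> y)"
    "cd_conj (x \<odot> y) = cd_neg (x \<odot> y)"
  using noncommuting_nonscalar[OF assms] nonscalar_conj[of _ n] anticommute[OF assms] assms by auto

section \<open>Independent triples and their associators\<close>

text \<open>
  Linear independence of the images in the quotient by \<open>\<plusminus>1\<close>. It is phrased by commutation, which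
  an automorphism visibly preserves: two elements fail to commute exactly when their images are
  linearly independent.
\<close>

definition indep :: "cd \<Rightarrow> cd \<Rightarrow> cd \<Rightarrow> bool" where
  "indep x y z \<longleftrightarrow> x \<odot> y \<noteq> y \<odot> x \<and> y \<odot> z \<noteq> z \<odot> y \<and> x \<odot> z \<noteq> z \<odot> x
    \<and> (x \<odot> y) \<odot> z \<noteq> z \<odot> (x \<odot> y) \<and> x \<odot> (y \<odot> z) \<noteq> (y \<odot> z) \<odot> x"

definition assoc :: "cd \<Rightarrow> cd \<Rightarrow> cd \<Rightarrow> bool" where
  "assoc x y z \<longleftrightarrow> (x \<odot> y) \<odot> z = x \<odot> (y \<odot> z)"

lemma Ext_in_cd_set [simp]: "Ext u i \<in> cd_set (Suc m) \<longleftrightarrow> u \<in> cd_set m"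
  by auto

declare cd_set.simps(2) [simp del]

text \<open>
  The two bracketings in \<open>Q\<^sub>m\<^sub>+\<^sub>1\<close> reduce, by the doubling formulas, to rearranged products of \<open>u\<close>, \<open>v\<close>
  and \<open>w\<close>. By independence every factor and every intermediate product is negated by conjugation and
  anticommutes with its partner, so each rearrangement costs a sign; the signs add up to \<open>i + k\<close>.
\<close>

lemma assoc_Ext_iff:
  assumes "u \<in> cd_set m" "v \<in> cd_set m" "w \<in> cd_set m" "indep u v w"
  shows "assoc (Ext u i) (Ext v j) (Ext w k) \<longleftrightarrow> (assoc u v w \<longleftrightarrow> i = k)"
proof -
  note I = assms(4)[unfolded indep_def]
  note N = cd_mult_neg[of _ m] noncommuting_conj[of u m v] noncommuting_conj[of v m w]
    noncommuting_conj[of "u \<odot> v" m w] noncommuting_conj[of u m "v \<odot> w"]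
  have 1: "w \<odot> (u \<odot> v) = cd_neg ((u \<odot> v) \<odot> w)" "(v \<odot> w) \<odot> u = cd_neg (u \<odot> (v \<odot> w))"
    "v \<odot> u = cd_neg (u \<odot> v)" "w \<odot> v = cd_neg (v \<odot> w)" "cd_conj u = cd_neg u"
    "cd_conj v = cd_neg v" "cd_conj w = cd_neg w"
    "cd_conj (u \<odot> v) = cd_neg (u \<odot> v)" "cd_conj (v \<odot> w) = cd_neg (v \<odot> w)"
    using I N assms by auto
  have 2: "(u \<odot> v) \<odot> w = u \<odot> (v \<odot> w) \<or> (u \<odot> v) \<odot> w = cd_neg (u \<odot> (v \<odot> w))"
    using assoc_up_to_sign assms(1-3) .
  have 3: "cd_neg (u \<odot> (v \<odot> w)) \<noteq> u \<odot> (v \<odot> w)"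
    using assms cd_neg_neq[of "u \<odot> (v \<odot> w)" m] by simp
  show ?thesis
    using 2 3 assms(1-3)
    by (cases i; cases j; cases k) (auto simp: assoc_def 1 cd_mult_neg[of _ m])
qed

lemma scalar_iff_idx:
  "x \<in> cd_set n \<Longrightarrow> scalar n x \<longleftrightarrow> idx x = (\<lambda>i. False)"
proof -
  assume x: "x \<in> cd_set n"
  have "idx (cd_one n) = (\<lambda>i. False)"
  proof (induction n)
    case (Suc n)
    show ?case by (rule ext) (simp add: Suc split: nat.split)
  qed simp
  then show ?thesis
    using idx_eq_iff[of x n "cd_one n"] x by (simp add: scalar_def)
qed

text \<open>
  Products in \<open>Q\<^sub>m\<^sub>+\<^sub>1\<close> have first components that are known only up to sign and conjugation; this
  allows replacing them by plain products when commutation is at stake.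
\<close>

lemma commute_idx_cong:
  assumes "x \<in> cd_set n" "y \<in> cd_set n" "x' \<in> cd_set n" "y' \<in> cd_set n"
    and "idx x = idx x'" "idx y = idx y'"
  shows "x \<odot> y = y \<odot> x \<longleftrightarrow> x' \<odot> y' = y' \<odot> x'"
proof -
  have "x = x' \<or> x = cd_neg x'" "y = y' \<or> y = cd_neg y'"
    using assms idx_eq_iff by blast+
  then show ?thesis using assms(3,4) by (elim disjE) (simp_all add: cd_mult_neg[of _ n])
qed

lemma noncommuting_mult:
  assumes "x \<in> cd_set n" "y \<in> cd_set n" "x \<odot> y \<noteq> y \<odot> x"
  shows "x \<odot> (x \<odot> y) \<noteq> (x \<odot> y) \<odot> x"
proof
  assume "x \<odot> (x \<odot> y) = (x \<odot> y) \<odot> x"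
  then have "idx x = idx (x \<odot> y)"
    using commute_imp[of x n "x \<odot> y"] noncommuting_nonscalar[OF assms] assms idx_eq_iff[of x n "x \<odot> y"]
    by auto
  then have "idx y = (\<lambda>i. False)"
    using assms by (auto simp: idx_mult[of _ n] fun_eq_iff)
  then show False
    using scalar_iff_idx noncommuting_nonscalar[OF assms] assms by blast
qed

text \<open>
  One form of the multiplication that covers all four cases of the definition, at the price of
  fixing the first component only up to sign.
\<close>

lemma Ext_mult:
  assumes "u \<in> cd_set m" "v \<in> cd_set m"
  obtains p where "Ext u i \<odot> Ext v j = Ext p (i \<noteq> j)" "p \<in> cd_set m" "idx p = idx (u \<odot> v)"
  using assms by (cases i; cases j) (auto simp: idx_mult[of _ m])

lemma noncommuting_Ext:
  assumes "u \<in> cd_set m" "v \<in> cd_set m" "u \<odot> v \<noteq> v \<odot> u"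
  shows "Ext u i \<odot> Ext v j \<noteq> Ext v j \<odot> Ext u i"
  using assms noncommuting_conj[OF assms] cd_neg_neq[of "u \<odot> v" m]
  by (cases i; cases j) (auto simp: cd_mult_neg[of _ m])

lemma indep_Ext:
  assumes "u \<in> cd_set m" "v \<in> cd_set m" "w \<in> cd_set m" "indep u v w"
  shows "indep (Ext u i) (Ext v j) (Ext w k)"
proof -
  note I = assms(4)[unfolded indep_def]
  obtain p where p: "Ext u i \<odot> Ext v j = Ext p (i \<noteq> j)" "p \<in> cd_set m" "idx p = idx (u \<odot> v)"
    using Ext_mult assms by metis
  obtain q where q: "Ext v j \<odot> Ext w k = Ext q (j \<noteq> k)" "q \<in> cd_set m" "idx q = idx (v \<odot> w)"
    using Ext_mult assms by metis
  have "p \<odot> w \<noteq> w \<odot> p" "u \<odot> q \<noteq> q \<odot> u"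
    using p q I assms commute_idx_cong[of p m w "u \<odot> v" w] commute_idx_cong[of u m q u "v \<odot> w"]
    by auto
  then show ?thesis
    unfolding indep_def p q using I p q assms by (metis noncommuting_Ext)
qed

lemma commute_Ext_scalar_iff:
  assumes "u \<in> cd_set m" "scalar m c"
  shows "Ext u i \<odot> Ext c True = Ext c True \<odot> Ext u i \<longleftrightarrow> scalar m u"
proof -
  have "c = cd_one m \<or> c = cd_neg (cd_one m)" using assms(2) by (simp add: scalar_def)
  moreover have "cd_conj u = u \<longleftrightarrow> scalar m u"
    using scalar_conj[of m u] nonscalar_conj[of u m] cd_neg_neq[of u m] assms(1)
    by (cases "scalar m u") auto
  ultimately show ?thesis
    using assms(1)
    by (elim disjE; cases i) (simp_all add: cd_mult_one cd_mult_neg[of _ m] eq_commute)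
qed

lemma commute_conj_iff:
  assumes "x \<in> cd_set n" "y \<in> cd_set n"
  shows "x \<odot> cd_conj y = cd_conj y \<odot> x \<longleftrightarrow> x \<odot> y = y \<odot> x"
  using commute_idx_cong[of x n "cd_conj y" x y] assms by simp

lemma assoc_scalar_right_iff:
  assumes "u \<in> cd_set m" "v \<in> cd_set m" "scalar m c"
  shows "assoc (Ext u i) (Ext v j) (Ext c True) \<longleftrightarrow> u \<odot> v = v \<odot> u"
proof -
  have "c = cd_one m \<or> c = cd_neg (cd_one m)" using assms(3) by (simp add: scalar_def)
  then show ?thesis
    using assms(1,2) commute_conj_iff[of u m v] commute_conj_iff[of v m u]
    by (elim disjE; cases i; cases j)
      (simp_all add: assoc_def cd_mult_one cd_mult_neg[of _ m] eq_commute)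
qed

lemma assoc_scalar_middle_iff:
  assumes "u \<in> cd_set m" "v \<in> cd_set m" "scalar m c"
  shows "assoc (Ext u i) (Ext c True) (Ext v j) \<longleftrightarrow> u \<odot> v = v \<odot> u"
proof -
  have "c = cd_one m \<or> c = cd_neg (cd_one m)" using assms(3) by (simp add: scalar_def)
  then show ?thesis
    using assms(1,2) commute_conj_iff[of u m v] commute_conj_iff[of v m u]
    by (elim disjE; cases i; cases j)
      (simp_all add: assoc_def cd_mult_one cd_mult_neg[of _ m] cd_conj_mult[of _ m] eq_commute)
qed

text \<open>
  Independence from \<open>\<plusminus>e\<close> amounts to independence of the first components, since \<open>\<plusminus>1\<close> and \<open>\<plusminus>e\<close> are the
  elements with first component \<open>\<plusminus>1\<close>.
\<close>

lemma indep_scalar_right_iff: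
  assumes "u \<in> cd_set m" "v \<in> cd_set m" "scalar m c"
  shows "indep (Ext u i) (Ext v j) (Ext c True) \<longleftrightarrow> u \<odot> v \<noteq> v \<odot> u"
proof -
  have c: "c \<in> cd_set m" "idx c = (\<lambda>i. False)"
    using assms(3) scalar_in_cd_set scalar_iff_idx by blast+
  obtain p where p: "Ext u i \<odot> Ext v j = Ext p (i \<noteq> j)" "p \<in> cd_set m" "idx p = idx (u \<odot> v)"
    using Ext_mult assms by metis
  obtain q where q: "Ext v j \<odot> Ext c True = Ext q (\<not> j)" "q \<in> cd_set m" "idx q = idx (v \<odot> c)"
    using Ext_mult[of v m c j True] assms c by auto
  have qv: "idx q = idx v"
    using q c assms by (simp add: idx_mult[of _ m])
  have sp: "scalar m p \<longleftrightarrow> scalar m (u \<odot> v)"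
    using p assms by (simp add: scalar_iff_idx)
  show ?thesis
  proof
    assume I: "indep (Ext u i) (Ext v j) (Ext c True)"
    show "u \<odot> v \<noteq> v \<odot> u"
    proof
      assume "u \<odot> v = v \<odot> u"
      then have "scalar m u \<or> scalar m v \<or> idx u = idx v"
        using commute_imp[of u m v] assms by auto
      moreover have "\<not> scalar m u" "\<not> scalar m v" "\<not> scalar m p"
        using I assms p unfolding indep_def by (metis commute_Ext_scalar_iff)+
      moreover have "idx u = idx v \<Longrightarrow> scalar m p"
        using p assms by (simp add: scalar_iff_idx idx_mult[of _ m])
      ultimately show False by blast
    qed
  next
    assume nc: "u \<odot> v \<noteq> v \<odot> u"
    have "u \<odot> q \<noteq> q \<odot> u"
      using nc commute_idx_cong[OF assms(1) q(2) assms(1,2) refl qv] by simp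
    then show "indep (Ext u i) (Ext v j) (Ext c True)"
      unfolding indep_def p q using nc noncommuting_nonscalar[of u m v] sp assms p q
      by (metis noncommuting_Ext commute_Ext_scalar_iff)
  qed
qed

lemma indep_scalar_middle_iff:
  assumes "u \<in> cd_set m" "v \<in> cd_set m" "scalar m c"
  shows "indep (Ext u i) (Ext c True) (Ext v j) \<longleftrightarrow> u \<odot> v \<noteq> v \<odot> u"
proof -
  have c: "c \<in> cd_set m" "idx c = (\<lambda>i. False)"
    using assms(3) scalar_in_cd_set scalar_iff_idx by blast+
  obtain p where p: "Ext u i \<odot> Ext c True = Ext p (\<not> i)" "p \<in> cd_set m" "idx p = idx (u \<odot> c)"
    using Ext_mult[of u m c i True] assms c by auto
  obtain q where q: "Ext c True \<odot> Ext v j = Ext q (\<not> j)" "q \<in> cd_set m" "idx q = idx (c \<odot> v)"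
    using Ext_mult[of c m v True j] assms c by auto
  have pu: "idx p = idx u" and qv: "idx q = idx v"
    using p q c assms by (simp_all add: idx_mult[of _ m])
  note R = commute_Ext_scalar_iff[OF assms(1,3), of i]
  note L = commute_Ext_scalar_iff[OF assms(2,3), of j]
  show ?thesis
  proof
    assume I: "indep (Ext u i) (Ext c True) (Ext v j)"
    show "u \<odot> v \<noteq> v \<odot> u"
    proof
      assume "u \<odot> v = v \<odot> u"
      then have "scalar m u \<or> scalar m v \<or> idx u = idx v"
        using commute_imp[of u m v] assms by auto
      moreover have "\<not> scalar m u" "\<not> scalar m v"
        using I unfolding indep_def R[symmetric] L[symmetric]
        by (simp_all only: eq_commute[of "Ext c True \<odot> Ext v j"] not_False_eq_True)
      moreover have "idx u \<noteq> idx v"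
      proof
        assume uv: "idx u = idx v"
        \<comment> \<open>Here \<open>Ext v j\<close> agrees up to sign with \<open>Ext u i\<close> or with \<open>Ext u i\<close> times \<open>e\<close>.\<close>
        have *: "x \<odot> y = y \<odot> x" if "idx x = idx y" "x \<in> cd_set (Suc m)" "y \<in> cd_set (Suc m)" for x y
          using commute_idx_cong[OF that(2,3,2,2) refl that(1)[symmetric]] by blast
        have "Ext u i \<odot> Ext v j = Ext v j \<odot> Ext u i \<or> Ext p (\<not> i) \<odot> Ext v j = Ext v j \<odot> Ext p (\<not> i)"
        proof (cases "i = j")
          case True
          then show ?thesis using *[of "Ext u i" "Ext v j"] uv assms by simp
        next
          case False
          then show ?thesis using *[of "Ext p (\<not> i)" "Ext v j"] uv pu p assms by simp
        qed
        then show False using I p unfolding indep_def by simp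
      qed
      ultimately show False by blast
    qed
  next
    assume nc: "u \<odot> v \<noteq> v \<odot> u"
    have "u \<odot> q \<noteq> q \<odot> u" "p \<odot> v \<noteq> v \<odot> p"
      using nc commute_idx_cong[OF assms(1) q(2) assms(1,2) refl qv]
        commute_idx_cong[OF p(2) assms(2,1,2) pu refl] by simp_all
    then have "Ext u i \<odot> Ext q (\<not> j) \<noteq> Ext q (\<not> j) \<odot> Ext u i"
      and "Ext p (\<not> i) \<odot> Ext v j \<noteq> Ext v j \<odot> Ext p (\<not> i)"
      using noncommuting_Ext assms(1,2) p(2) q(2) by blast+
    moreover have "Ext u i \<odot> Ext v j \<noteq> Ext v j \<odot> Ext u i"
      using noncommuting_Ext assms(1,2) nc by blast
    moreover have "Ext u i \<odot> Ext c True \<noteq> Ext c True \<odot> Ext u i"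
      using R noncommuting_nonscalar(1)[OF assms(1,2) nc] by blast
    moreover have "Ext c True \<odot> Ext v j \<noteq> Ext v j \<odot> Ext c True"
      unfolding eq_commute[of "Ext c True \<odot> Ext v j"]
      using L noncommuting_nonscalar(2)[OF assms(1,2) nc] by blast
    ultimately show "indep (Ext u i) (Ext c True) (Ext v j)"
      unfolding indep_def p(1) q(1) by blast
  qed
qed

lemma not_scalar_Ext_True [simp]: "\<not> scalar (Suc n) (Ext u True)"
  by (auto simp: scalar_def)

lemma scalar_Ext_False [simp]: "scalar (Suc n) (Ext u False) \<longleftrightarrow> scalar n u"
  by (auto simp: scalar_def)

lemma scalar_one [simp]: "scalar n (cd_one n)"
  by (simp add: scalar_def)

section \<open>Characterising the doubling unit\<close>

lemma exists_noncommuting: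
  assumes "k \<ge> 2" "c \<in> cd_set k" "\<not> scalar k c"
  shows "\<exists>w\<in>cd_set k. c \<odot> w \<noteq> w \<odot> c"
proof -
  obtain j where k: "k = Suc (Suc j)"
    using assms(1) by (metis add_2_eq_Suc le_Suc_ex)
  obtain s t where c: "c = Ext s t" "s \<in> cd_set (Suc j)"
    using assms(2) unfolding k by (elim cd_set_SucE) auto
  show ?thesis
  proof (cases "scalar (Suc j) s")
    case True
    then have "t" using assms(3) c k by (cases t) auto
    have "\<not> scalar (Suc j) (Ext (cd_one j) True)" by simp
    then have "c \<odot> Ext (Ext (cd_one j) True) False \<noteq> Ext (Ext (cd_one j) True) False \<odot> c"
      using commute_Ext_scalar_iff[of "Ext (cd_one j) True" "Suc j" s False] True \<open>t\<close> c
      by (metis Ext_in_cd_set cd_one_in_cd_set)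
    then show ?thesis unfolding k by (metis Ext_in_cd_set cd_one_in_cd_set)
  next
    case False
    then have "c \<odot> Ext (cd_one (Suc j)) True \<noteq> Ext (cd_one (Suc j)) True \<odot> c"
      using commute_Ext_scalar_iff[of s "Suc j" "cd_one (Suc j)" t] c by (metis scalar_one)
    then show ?thesis unfolding k by (metis Ext_in_cd_set cd_one_in_cd_set)
  qed
qed

lemma exists_nonscalar: "k \<ge> 1 \<Longrightarrow> \<exists>c\<in>cd_set k. \<not> scalar k c"
  using not_scalar_Ext_True Ext_in_cd_set cd_one_in_cd_set by (metis Suc_le_D One_nat_def)

text \<open>
  The unit \<open>e'\<close> of \<open>Q\<^sub>m\<close> is always part of the triple: if \<open>b\<close> is not \<open>\<plusminus>1\<close> or \<open>\<plusminus>e'\<close>, it is put in the middle, and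
  otherwise \<open>b\<close> itself plays its role. The bound \<open>m \<ge> 3\<close> leaves a noncommuting pair one level below.
\<close>

lemma exists_indep_nonassoc:
  assumes "m \<ge> 3" "b \<in> cd_set m" "\<not> scalar m b"
  shows "\<exists>u\<in>cd_set m. \<exists>v\<in>cd_set m. indep u v b \<and> \<not> assoc u v b"
proof -
  obtain k where m: "m = Suc k" and k: "k \<ge> 2"
    using assms(1) by (cases m) auto
  obtain c d where b: "b = Ext c d" "c \<in> cd_set k"
    using assms(2) unfolding m by (elim cd_set_SucE) auto
  show ?thesis
  proof (cases "scalar k c")
    case True
    then have "d" using assms(3) b m by (cases d) auto
    obtain p q where "p \<in> cd_set k" "q \<in> cd_set k" "p \<odot> q \<noteq> q \<odot> p"
      using exists_nonscalar[of k] exists_noncommuting[of k] k by fastforce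
    then have "indep (Ext p False) (Ext q False) b \<and> \<not> assoc (Ext p False) (Ext q False) b"
      using indep_scalar_right_iff assoc_scalar_right_iff True b \<open>d\<close> by simp
    then show ?thesis
      using \<open>p \<in> cd_set k\<close> \<open>q \<in> cd_set k\<close> unfolding m by (metis Ext_in_cd_set)
  next
    case False
    then obtain w where w: "w \<in> cd_set k" "w \<odot> c \<noteq> c \<odot> w"
      using exists_noncommuting[of k c] k b by metis
    let ?e = "Ext (cd_one k) True"
    have "indep (Ext w False) ?e b \<and> \<not> assoc (Ext w False) ?e b"
      using indep_scalar_middle_iff assoc_scalar_middle_iff w b by simp
    then show ?thesis
      using w unfolding m by (metis Ext_in_cd_set cd_one_in_cd_set)
  qed
qed

text \<open>
  In the octonion loop \<open>Q\<^sub>3\<close> all elements have this property, because independent triples never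
  associate there. For \<open>n \<ge> 4\<close> it singles out \<open>\<plusminus>1\<close> and \<open>\<plusminus>e\<close>.
\<close>

definition octonionic :: "nat \<Rightarrow> cd \<Rightarrow> bool" where
  "octonionic n a \<longleftrightarrow> (\<forall>x\<in>cd_set n. \<forall>y\<in>cd_set n. indep x y a \<longrightarrow> \<not> assoc x y a)"

lemma octonionic_unit: "octonionic (Suc m) (Ext (cd_one m) True)"
  unfolding octonionic_def
proof (intro ballI impI)
  fix x y assume "x \<in> cd_set (Suc m)" "y \<in> cd_set (Suc m)" "indep x y (Ext (cd_one m) True)"
  then show "\<not> assoc x y (Ext (cd_one m) True)"
    by (elim cd_set_SucE) (simp_all add: indep_scalar_right_iff assoc_scalar_right_iff)
qed

lemma octonionic_imp_scalar_Ext: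
  assumes "m \<ge> 3" "a \<in> cd_set (Suc m)" "octonionic (Suc m) a" "\<not> scalar (Suc m) a"
  obtains c where "scalar m c" "a = Ext c True"
proof -
  obtain b d where a: "a = Ext b d" "b \<in> cd_set m"
    using assms(2) by (elim cd_set_SucE) auto
  show thesis
  proof (cases "scalar m b")
    case True
    then show ?thesis using that[of b] a assms(4) by (cases d) auto
  next
    case False
    then obtain u v where uv: "u \<in> cd_set m" "v \<in> cd_set m" "indep u v b" "\<not> assoc u v b"
      using exists_indep_nonassoc[OF assms(1), of b] a by blast
    \<comment> \<open>The second components \<open>\<not> d\<close> and \<open>d\<close> at the two ends differ, which turns a nonassociating
      triple into an associating one.\<close>
    have "indep (Ext u (\<not> d)) (Ext v False) a" "assoc (Ext u (\<not> d)) (Ext v False) a"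
      using indep_Ext[of u m v b] assoc_Ext_iff[of u m v b] uv a by auto
    then show ?thesis using assms(3) uv unfolding octonionic_def by (metis Ext_in_cd_set)
  qed
qed

section \<open>First and second components\<close>

primrec lower :: "cd \<Rightarrow> cd" where
  "lower (Base k) = Base k"
| "lower (Ext x a) = x"

primrec upper :: "cd \<Rightarrow> bool" where
  "upper (Base k) = False"
| "upper (Ext x a) = a"

lemma lower_in_cd_set [simp]: "x \<in> cd_set (Suc m) \<Longrightarrow> lower x \<in> cd_set m"
  by (elim cd_set_SucE) auto

lemma Ext_lower_upper: "x \<in> cd_set (Suc m) \<Longrightarrow> Ext (lower x) (upper x) = x"
  by (elim cd_set_SucE) auto

lemma upper_mult:
  assumes "x \<in> cd_set (Suc m)" "y \<in> cd_set (Suc m)"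
  shows "upper (x \<odot> y) \<longleftrightarrow> upper x \<noteq> upper y"
  using assms by (elim cd_set_SucE) auto

lemma idx_lower_mult:
  assumes "x \<in> cd_set (Suc m)" "y \<in> cd_set (Suc m)"
  shows "idx (lower (x \<odot> y)) = idx (lower x \<odot> lower y)"
  using assms by (elim cd_set_SucE) (auto simp: idx_mult[of _ m])

lemma assoc_iff_lower:
  assumes "x \<in> cd_set (Suc m)" "y \<in> cd_set (Suc m)" "z \<in> cd_set (Suc m)"
    and "indep (lower x) (lower y) (lower z)"
  shows "assoc x y z \<longleftrightarrow> (assoc (lower x) (lower y) (lower z) \<longleftrightarrow> upper x = upper z)"
  using assoc_Ext_iff[of "lower x" m "lower y" "lower z" "upper x" "upper y" "upper z"] assms
  by (simp add: Ext_lower_upper)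

text \<open>
  Commutation of first components refers to the doubling, but the right-hand side refers only to
  the multiplication and \<open>\<plusminus>e\<close>. An automorphism that fixes \<open>e\<close> up to sign therefore preserves it, and
  with it the independence of first components.
\<close>

lemma lower_commute_iff:
  assumes "x \<in> cd_set (Suc m)" "y \<in> cd_set (Suc m)" "scalar m c"
  shows "lower x \<odot> lower y = lower y \<odot> lower x \<longleftrightarrow> assoc x y (Ext c True)"
  using assoc_scalar_right_iff[of "lower x" m "lower y" c "upper x" "upper y"] assms
  by (simp add: Ext_lower_upper)

lemma indep_lower_iff:
  assumes "x \<in> cd_set (Suc m)" "y \<in> cd_set (Suc m)" "z \<in> cd_set (Suc m)" "scalar m c"
  defines "e \<equiv> Ext c True"
  shows "indep (lower x) (lower y) (lower z) \<longleftrightarrow>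
    \<not> assoc x y e \<and> \<not> assoc y z e \<and> \<not> assoc x z e \<and> \<not> assoc (x \<odot> y) z e \<and> \<not> assoc x (y \<odot> z) e"
proof -
  have xy: "x \<odot> y \<in> cd_set (Suc m)" and yz: "y \<odot> z \<in> cd_set (Suc m)"
    using assms(1-3) cd_mult_in_cd_set by blast+
  have 1: "(lower x \<odot> lower y) \<odot> lower z = lower z \<odot> (lower x \<odot> lower y) \<longleftrightarrow> assoc (x \<odot> y) z e"
    unfolding e_def lower_commute_iff[OF xy assms(3,4), symmetric]
    by (rule commute_idx_cong[of _ m]) (use assms(1-3) xy in \<open>simp_all add: idx_lower_mult\<close>)
  have 2: "lower x \<odot> (lower y \<odot> lower z) = (lower y \<odot> lower z) \<odot> lower x \<longleftrightarrow> assoc x (y \<odot> z) e"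
    unfolding e_def lower_commute_iff[OF assms(1) yz assms(4), symmetric]
    by (rule commute_idx_cong[of _ m]) (use assms(1-3) yz in \<open>simp_all add: idx_lower_mult\<close>)
  show ?thesis
    unfolding indep_def 1 2 lower_commute_iff[OF assms(1,2,4)] lower_commute_iff[OF assms(2,3,4)]
      lower_commute_iff[OF assms(1,3,4)] e_def ..
qed

section \<open>Automorphisms\<close>

locale cd_automorphism =
  fixes m :: nat and \<phi> :: "cd \<Rightarrow> cd"
  assumes m_ge_3: "m \<ge> 3"
    and bij: "bij_betw \<phi> (cd_set (Suc m)) (cd_set (Suc m))"
    and hom: "x \<in> cd_set (Suc m) \<Longrightarrow> y \<in> cd_set (Suc m) \<Longrightarrow> \<phi> (x \<odot> y) = \<phi> x \<odot> \<phi> y"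
begin

lemma in_set: "x \<in> cd_set (Suc m) \<Longrightarrow> \<phi> x \<in> cd_set (Suc m)"
  using bij bij_betwE by blast

lemma eq_iff: "x \<in> cd_set (Suc m) \<Longrightarrow> y \<in> cd_set (Suc m) \<Longrightarrow> \<phi> x = \<phi> y \<longleftrightarrow> x = y"
  using bij by (auto simp: bij_betw_def inj_on_def)

text \<open>
  The neutral element is the only idempotent.
\<close>

lemma map_one: "\<phi> (cd_one (Suc m)) = cd_one (Suc m)"
proof -
  let ?o = "cd_one (Suc m)"
  have "\<phi> ?o \<odot> \<phi> ?o = \<phi> ?o"
    using hom[of ?o ?o] cd_mult_one(1)[of ?o "Suc m"] cd_one_in_cd_set by metis
  then have "\<phi> ?o = (if scalar (Suc m) (\<phi> ?o) then ?o else cd_neg ?o)"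
    using cd_square[of "\<phi> ?o" "Suc m"] in_set[of ?o] cd_one_in_cd_set by metis
  then show ?thesis
    by (metis scalar_neg scalar_one)
qed

text \<open>
  Squares equal \<open>1\<close> for \<open>\<plusminus>1\<close> only, and \<open>1\<close> is already the image of \<open>1\<close>.
\<close>

lemma map_neg_one: "\<phi> (cd_neg (cd_one (Suc m))) = cd_neg (cd_one (Suc m))"
proof -
  let ?o = "cd_one (Suc m)" and ?p = "cd_neg (cd_one (Suc m))"
  have p: "?p \<in> cd_set (Suc m)" and ne: "?p \<noteq> ?o"
    using cd_one_in_cd_set cd_neg_in_cd_set cd_neg_neq by blast+
  have "?p \<odot> ?p = ?o"
    using cd_square[of ?p "Suc m"] p by (metis scalar_neg scalar_one)
  then have "\<phi> ?p \<odot> \<phi> ?p = ?o"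
    using hom[of ?p ?p] p map_one by metis
  then have "scalar (Suc m) (\<phi> ?p)"
    using cd_square[of "\<phi> ?p" "Suc m"] in_set[of ?p] p ne by metis
  moreover have "\<phi> ?p \<noteq> ?o"
    using eq_iff[of ?p ?o] p map_one ne cd_one_in_cd_set by metis
  ultimately show ?thesis
    unfolding scalar_def by blast
qed

lemma map_neg: "x \<in> cd_set (Suc m) \<Longrightarrow> \<phi> (cd_neg x) = cd_neg (\<phi> x)"
  using hom[of "cd_neg (cd_one (Suc m))" x] map_neg_one in_set[of x]
    cd_mult_neg(1)[of "cd_one (Suc m)" "Suc m"] cd_mult_one(1)[of _ "Suc m"]
  by (metis cd_neg_in_cd_set cd_one_in_cd_set)

lemma scalar_iff: "x \<in> cd_set (Suc m) \<Longrightarrow> scalar (Suc m) (\<phi> x) \<longleftrightarrow> scalar (Suc m) x"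
  unfolding scalar_def using eq_iff map_one map_neg_one cd_neg_in_cd_set cd_one_in_cd_set by metis

lemma assoc_iff:
  assumes "x \<in> cd_set (Suc m)" "y \<in> cd_set (Suc m)" "z \<in> cd_set (Suc m)"
  shows "assoc (\<phi> x) (\<phi> y) (\<phi> z) \<longleftrightarrow> assoc x y z"
  unfolding assoc_def using assms hom eq_iff cd_mult_in_cd_set by metis

lemma indep_iff:
  assumes "x \<in> cd_set (Suc m)" "y \<in> cd_set (Suc m)" "z \<in> cd_set (Suc m)"
  shows "indep (\<phi> x) (\<phi> y) (\<phi> z) \<longleftrightarrow> indep x y z"
proof -
  have c: "\<phi> x \<odot> \<phi> y = \<phi> y \<odot> \<phi> x \<longleftrightarrow> x \<odot> y = y \<odot> x"
    if "x \<in> cd_set (Suc m)" "y \<in> cd_set (Suc m)" for x y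
    using that hom eq_iff cd_mult_in_cd_set by metis
  have xy: "x \<odot> y \<in> cd_set (Suc m)" and yz: "y \<odot> z \<in> cd_set (Suc m)"
    using assms cd_mult_in_cd_set by blast+
  have 1: "(\<phi> x \<odot> \<phi> y) \<odot> \<phi> z = \<phi> z \<odot> (\<phi> x \<odot> \<phi> y) \<longleftrightarrow> (x \<odot> y) \<odot> z = z \<odot> (x \<odot> y)"
    using c[OF xy assms(3)] hom[OF assms(1,2)] by simp
  have 2: "\<phi> x \<odot> (\<phi> y \<odot> \<phi> z) = (\<phi> y \<odot> \<phi> z) \<odot> \<phi> x \<longleftrightarrow> x \<odot> (y \<odot> z) = (y \<odot> z) \<odot> x"
    using c[OF assms(1) yz] hom[OF assms(2,3)] by simp
  show ?thesis
    unfolding indep_def 1 2 c[OF assms(1,2)] c[OF assms(2,3)] c[OF assms(1,3)] ..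
qed

lemma map_unit:
  obtains c where "scalar m c" "\<phi> (Ext (cd_one m) True) = Ext c True"
proof -
  let ?e = "Ext (cd_one m) True"
  have e: "?e \<in> cd_set (Suc m)" by simp
  have "octonionic (Suc m) (\<phi> ?e)"
    unfolding octonionic_def
  proof (intro ballI impI)
    fix x y assume "x \<in> cd_set (Suc m)" "y \<in> cd_set (Suc m)" and I: "indep x y (\<phi> ?e)"
    then obtain x' y' where "x = \<phi> x'" "x' \<in> cd_set (Suc m)" "y = \<phi> y'" "y' \<in> cd_set (Suc m)"
      using bij unfolding bij_betw_def by (metis imageE)
    then show "\<not> assoc x y (\<phi> ?e)"
      using I octonionic_unit[of m] e indep_iff assoc_iff unfolding octonionic_def by metis
  qed
  then show thesis
    using octonionic_imp_scalar_Ext[OF m_ge_3 in_set[OF e]] scalar_iff[OF e] that by auto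
qed

lemma indep_lower_map_iff:
  assumes "x \<in> cd_set (Suc m)" "y \<in> cd_set (Suc m)" "z \<in> cd_set (Suc m)"
  shows "indep (lower (\<phi> x)) (lower (\<phi> y)) (lower (\<phi> z)) \<longleftrightarrow> indep (lower x) (lower y) (lower z)"
proof -
  obtain c where c: "scalar m c" "\<phi> (Ext (cd_one m) True) = Ext c True" using map_unit .
  have e: "Ext (cd_one m) True \<in> cd_set (Suc m)" by simp
  have xy: "x \<odot> y \<in> cd_set (Suc m)" and yz: "y \<odot> z \<in> cd_set (Suc m)"
    using assms cd_mult_in_cd_set by blast+
  show ?thesis
    unfolding indep_lower_iff[OF assms scalar_one] indep_lower_iff[OF assms[THEN in_set] c(1)]
    unfolding c(2)[symmetric] hom[OF assms(1,2), symmetric] hom[OF assms(2,3), symmetric]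
    using assoc_iff assms xy yz e by simp
qed

text \<open>
  That \<open>\<phi>\<close> maps \<open>Q\<^sub>m\<close> to itself means that this homomorphism to the group with two elements vanishes.
\<close>

definition \<chi> :: "cd \<Rightarrow> bool" where
  "\<chi> x = upper (\<phi> (Ext x False))"

lemma \<chi>_mult: "x \<in> cd_set m \<Longrightarrow> y \<in> cd_set m \<Longrightarrow> \<chi> (x \<odot> y) \<longleftrightarrow> \<chi> x \<noteq> \<chi> y"
  using hom[of "Ext x False" "Ext y False"] upper_mult[OF in_set in_set, of "Ext x False" "Ext y False"]
  by (simp add: \<chi>_def)

lemma \<chi>_scalar: "scalar m x \<Longrightarrow> \<not> \<chi> x"
  using map_one map_neg_one by (auto simp: \<chi>_def scalar_def)

text \<open>
  The witness \<open>f\<close> is the first component of the preimage \<open>F\<close> of \<open>(e', 0)\<close>, where \<open>e'\<close> is the unit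
  \<open>(1, 1)\<close> of \<open>Q\<^sub>m\<close>. If \<open>x\<close>, \<open>f\<close>, \<open>y\<close> are independent and do not associate, neither do \<open>(x, 0)\<close>, \<open>F\<close>,
  \<open>(y, 0)\<close>, nor their images. The first components of the images are again independent with \<open>e'\<close> in
  the middle, so they do not associate either, and \<open>assoc_Ext_iff\<close> leaves only equal second
  components.
\<close>

lemma exists_middle_witness:
  obtains k f where "m = Suc k" "k \<ge> 2" "f \<in> cd_set m" "\<not> scalar m f"
    "\<And>x y. x \<in> cd_set m \<Longrightarrow> y \<in> cd_set m \<Longrightarrow> indep x f y \<Longrightarrow> \<not> assoc x f y \<Longrightarrow> \<chi> x = \<chi> y"
proof -
  obtain k where k: "m = Suc k" "k \<ge> 2" using m_ge_3 by (cases m) auto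
  let ?e = "Ext (cd_one k) True"
  have eE: "Ext ?e False \<in> cd_set (Suc m)" by (simp add: k)
  then obtain F where F: "F \<in> cd_set (Suc m)" "\<phi> F = Ext ?e False"
    using bij unfolding bij_betw_def by (metis imageE)
  obtain c where c: "scalar m c" "\<phi> (Ext (cd_one m) True) = Ext c True" using map_unit .
  show thesis
  proof (rule that[of k "lower F"])
    show "lower F \<in> cd_set m" using F lower_in_cd_set by blast
    show "\<not> scalar m (lower F)"
    proof
      assume s: "scalar m (lower F)"
      have F': "Ext (lower F) (upper F) = F" using F Ext_lower_upper by blast
      have "idx (lower (\<phi> F)) = (\<lambda>i. False)"
      proof (cases "upper F")
        case True
        then have "F = Ext (cd_one m) True \<or> F = cd_neg (Ext (cd_one m) True)"
          using s F' by (auto simp: scalar_def)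
        then have "\<phi> F = Ext c True \<or> \<phi> F = Ext (cd_neg c) True"
          using c map_neg[of "Ext (cd_one m) True"] by auto
        then show ?thesis using c(1) scalar_iff_idx scalar_in_cd_set by fastforce
      next
        case False
        then have "scalar (Suc m) F"
          using s F' scalar_Ext_False[of m "lower F"] by simp
        then have "scalar (Suc m) (\<phi> F)" using scalar_iff F by blast
        then have "scalar m ?e" using F by simp
        then show ?thesis by (simp add: k)
      qed
      then show False using F k scalar_iff_idx[of ?e m] by simp
    qed
    fix x y assume xy: "x \<in> cd_set m" "y \<in> cd_set m" and I: "indep x (lower F) y"
      and A: "\<not> assoc x (lower F) y"
    let ?X = "Ext x False" and ?Y = "Ext y False"
    have XY: "?X \<in> cd_set (Suc m)" "?Y \<in> cd_set (Suc m)" using xy by simp_all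
    have "\<not> assoc ?X F ?Y"
      using assoc_iff_lower[OF XY(1) F(1) XY(2)] I A by simp
    then have 1: "\<not> assoc (\<phi> ?X) (\<phi> F) (\<phi> ?Y)"
      using assoc_iff XY F by blast
    have 2: "indep (lower (\<phi> ?X)) (lower (\<phi> F)) (lower (\<phi> ?Y))"
      using indep_lower_map_iff[OF XY(1) F(1) XY(2)] I by simp
    let ?u = "lower (\<phi> ?X)" and ?v = "lower (\<phi> ?Y)"
    have uv: "?u \<in> cd_set (Suc k)" "?v \<in> cd_set (Suc k)"
      using in_set XY k lower_in_cd_set by metis+
    have "indep (Ext (lower ?u) (upper ?u)) ?e (Ext (lower ?v) (upper ?v))"
      using 2 uv F by (simp add: Ext_lower_upper)
    then have "\<not> assoc (Ext (lower ?u) (upper ?u)) ?e (Ext (lower ?v) (upper ?v))"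
      unfolding indep_scalar_middle_iff[OF uv[THEN lower_in_cd_set] scalar_one]
        assoc_scalar_middle_iff[OF uv[THEN lower_in_cd_set] scalar_one] .
    then have "\<not> assoc ?u (lower (\<phi> F)) ?v"
      using uv F by (simp add: Ext_lower_upper)
    then show "\<chi> x = \<chi> y"
      using assoc_iff_lower[OF in_set in_set in_set, OF XY(1) F(1) XY(2)] 1 2 by (simp add: \<chi>_def)
  qed (use k in simp_all)
qed

text \<open>
  The witness \<open>f = (g, d)\<close> of \<open>exists_middle_witness\<close> is either \<open>\<plusminus>e'\<close>, and then \<open>\<chi>\<close> agrees on all
  \<open>x\<close> and \<open>y\<close> with noncommuting first components, or it is independent from \<open>e'\<close>, and then \<open>\<chi>\<close> has the
  value \<open>\<chi>(e')\<close> at every \<open>x\<close> whose first component does not commute with \<open>g\<close>. In both cases some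
  \<open>(w, 0)\<close> and \<open>(w, 1)\<close> have the same value; they differ by the factor \<open>e'\<close>, so \<open>\<chi>(e') = 0\<close>. From there
  multiplicativity reaches the other elements.
\<close>

lemma \<chi>_trivial:
  assumes "x \<in> cd_set m"
  shows "\<not> \<chi> x"
proof -
  obtain k f where k: "m = Suc k" "k \<ge> 2" and f: "f \<in> cd_set m" "\<not> scalar m f"
    and rel: "\<And>x y. x \<in> cd_set m \<Longrightarrow> y \<in> cd_set m \<Longrightarrow> indep x f y \<Longrightarrow> \<not> assoc x f y \<Longrightarrow> \<chi> x = \<chi> y"
    using exists_middle_witness by metis
  obtain g d where g: "f = Ext g d" "g \<in> cd_set k"
    using f(1) unfolding k(1) by (elim cd_set_SucE) auto
  let ?e = "Ext (cd_one k) True"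
  have S: "\<chi> (Ext w True) = (\<chi> (Ext w False) \<noteq> \<chi> ?e)" if "w \<in> cd_set k" for w
    using \<chi>_mult[of "Ext w False" ?e] that k by (simp add: cd_mult_one)
  obtain s t where x: "x = Ext s t" "s \<in> cd_set k"
    using assms unfolding k(1) by (elim cd_set_SucE) auto
  show ?thesis
  proof (cases "scalar k g")
    case True
    then have d using f g k by (cases d) auto
    have R: "\<chi> (Ext s t) = \<chi> (Ext q r)" if "s \<in> cd_set k" "q \<in> cd_set k" "s \<odot> q \<noteq> q \<odot> s" for s t q r
      using rel[of "Ext s t" "Ext q r"] indep_scalar_middle_iff[of s k q g t r]
        assoc_scalar_middle_iff[of s k q g t r] that True g k \<open>d\<close> by simp
    obtain p q where pq: "p \<in> cd_set k" "q \<in> cd_set k" "p \<odot> q \<noteq> q \<odot> p"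
      using exists_nonscalar[of k] exists_noncommuting[of k] k by fastforce
    have e: "\<not> \<chi> ?e"
      using S[OF pq(1)] R[OF pq, of True True] R[OF pq, of False True] by blast
    have s: "\<not> \<chi> (Ext s False)"
    proof (cases "scalar k s")
      case True
      then show ?thesis using \<chi>_scalar[of "Ext s False"] k by simp
    next
      case False
      then obtain w where w: "w \<in> cd_set k" "s \<odot> w \<noteq> w \<odot> s"
        using exists_noncommuting[of k s] k x by metis
      \<comment> \<open>Both \<open>w\<close> and \<open>s \<odot> w\<close> fail to commute with \<open>s\<close>, so \<open>\<chi>\<close> agrees on a pair and on its product.\<close>
      have "\<chi> (Ext s False) = \<chi> (Ext w False)" "\<chi> (Ext s False) = \<chi> (Ext (s \<odot> w) False)"
        using R[of s w] R[of s "s \<odot> w"] w x noncommuting_mult[of s k w] by simp_all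
      then show ?thesis using \<chi>_mult[of "Ext s False" "Ext w False"] w x k by simp
    qed
    then show ?thesis using S[of s] e x by (cases t) auto
  next
    case False
    have R: "\<chi> (Ext s t) = \<chi> ?e" if "s \<in> cd_set k" "s \<odot> g \<noteq> g \<odot> s" for s t
      using rel[of "Ext s t" ?e] indep_scalar_right_iff[of s k g "cd_one k" t d]
        assoc_scalar_right_iff[of s k g "cd_one k" t d] that g k by simp
    obtain w where w: "w \<in> cd_set k" "w \<odot> g \<noteq> g \<odot> w"
      using exists_noncommuting[of k g] k g False by metis
    have e: "\<not> \<chi> ?e"
      using S[OF w(1)] R[OF w, of True] R[OF w, of False] by blast
    have R': "\<not> \<chi> (Ext s t)" if "s \<in> cd_set k" "s \<odot> g \<noteq> g \<odot> s" for s t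
      using R that e by blast
    show ?thesis
    proof (cases "s \<odot> g = g \<odot> s")
      case True
      \<comment> \<open>Multiplying by \<open>w\<close>, where \<open>\<chi>\<close> vanishes, moves \<open>s\<close> to an element that does not commute with \<open>g\<close>.\<close>
      obtain p where p: "Ext s t \<odot> Ext w False = Ext p t" "p \<in> cd_set k" "idx p = idx (s \<odot> w)"
        using Ext_mult[of s k w t False] x w by auto
      have "p \<odot> g \<noteq> g \<odot> p"
      proof -
        consider "scalar k s" | "idx s = idx g"
          using True commute_imp[of s k g] False x g by auto
        then show ?thesis
        proof cases
          case 1
          then have "idx p = idx w"
            using p x w by (simp add: idx_mult[of _ k] scalar_iff_idx)
          then show ?thesis using commute_idx_cong[of p k g w g] p w g by simp
        next
          case 2
          then have "idx p = idx (g \<odot> w)"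
            using p x w g by (simp add: idx_mult[of _ k])
          then show ?thesis
            using commute_idx_cong[of p k g "g \<odot> w" g] noncommuting_mult[of g k w] p w g by simp
        qed
      qed
      then show ?thesis
        using \<chi>_mult[of x "Ext w False"] R'[of p t] R'[of w False] p w x k by simp
    next
      case False
      then show ?thesis using R' x by blast
    qed
  qed
qed

lemma map_Ext_False: "x \<in> cd_set m \<Longrightarrow> \<phi> (Ext x False) = Ext (lower (\<phi> (Ext x False))) False"
  using \<chi>_trivial[of x] Ext_lower_upper[OF in_set[of "Ext x False"]] by (simp add: \<chi>_def)

end

section \<open>The restriction to the subloop\<close>

lemma auto_iff:
  "h \<in> auto G \<longleftrightarrow> h \<in> extensional (carrier G) \<and> bij_betw h (carrier G) (carrier G)
    \<and> (\<forall>x\<in>carrier G. \<forall>y\<in>carrier G. h (x \<otimes>\<^bsub>G\<^esub> y) = h x \<otimes>\<^bsub>G\<^esub> h y)"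
  by (auto simp: auto_def hom_def Bij_def bij_betwE)

lemma Q_simps [simp]: "carrier (Q n) = cd_set n" "x \<otimes>\<^bsub>Q n\<^esub> y = x \<odot> y" "\<one>\<^bsub>Q n\<^esub> = cd_one n"
  by (simp_all add: Q_def)

lemma Q_sub_simps [simp]:
  "carrier (Q_sub n) = (\<lambda>x. Ext x False) ` cd_set n" "x \<otimes>\<^bsub>Q_sub n\<^esub> y = x \<odot> y"
  by (simp_all add: Q_sub_def)

theorem theorem32:
  fixes n :: nat and \<phi> \<psi> :: "cd \<Rightarrow> cd" and e :: cd
  assumes "n \<ge> 4"
    and "\<phi> \<in> auto (Q n)"
    and "\<psi> = restrict \<phi> (carrier (Q_sub (n - 1)))"
    and "e = Ext \<one>\<^bsub>Q (n - 1)\<^esub> True"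
  shows "(\<phi> \<one>\<^bsub>Q n\<^esub> = \<one>\<^bsub>Q n\<^esub> \<and> \<phi> (cd_neg \<one>\<^bsub>Q n\<^esub>) = cd_neg \<one>\<^bsub>Q n\<^esub>)
    \<and> (\<phi> e = e \<or> \<phi> e = cd_neg e)
    \<and> (\<phi> ` carrier (Q_sub (n - 1)) = carrier (Q_sub (n - 1))
        \<and> \<psi> \<in> auto (Q_sub (n - 1))
        \<and> (\<exists>\<psi>' \<in> auto (Q (n - 1)). \<forall>x \<in> carrier (Q (n - 1)). \<psi> (Ext x False) = Ext (\<psi>' x) False))
    \<and> (\<forall>x \<in> carrier (Q (n - 1)). \<phi> (Ext x True) = \<psi> (Ext x False) \<otimes>\<^bsub>Q n\<^esub> \<phi> e)"
proof -
  obtain m where n: "n = Suc m" and m: "m \<ge> 3"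
    using assms(1) by (cases n) auto
  have \<phi>: "\<phi> \<in> extensional (cd_set (Suc m))" "bij_betw \<phi> (cd_set (Suc m)) (cd_set (Suc m))"
    "\<And>x y. x \<in> cd_set (Suc m) \<Longrightarrow> y \<in> cd_set (Suc m) \<Longrightarrow> \<phi> (x \<odot> y) = \<phi> x \<odot> \<phi> y"
    using assms(2) unfolding n auto_iff Q_simps by blast+
  interpret cd_automorphism m \<phi>
    using m \<phi> by unfold_locales
  let ?S = "(\<lambda>x. Ext x False) ` cd_set m"
  have n1: "n - 1 = m" using n by simp
  have SS: "?S \<subseteq> cd_set (Suc m)" by auto
  have inj: "inj_on \<phi> ?S"
    using bij SS unfolding bij_betw_def by (metis inj_on_subset)
  have "\<phi> ` ?S \<subseteq> ?S"
    using map_Ext_False lower_in_cd_set[OF in_set[OF subsetD[OF SS]]] by blast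
  then have im: "\<phi> ` ?S = ?S"
    using inj finite_cd_set by (metis endo_inj_surj finite_imageI)
  have \<psi>: "\<psi> = restrict \<phi> ?S" using assms(3) unfolding n1 Q_sub_simps .
  have \<psi>_auto: "\<psi> \<in> auto (Q_sub m)"
  proof -
    have "bij_betw \<psi> ?S ?S"
      using inj im unfolding \<psi> by (simp add: bij_betw_def)
    moreover have "\<psi> (x \<odot> y) = \<psi> x \<odot> \<psi> y" if "x \<in> ?S" "y \<in> ?S" for x y
    proof -
      have "x \<odot> y \<in> ?S" using that by auto
      then show ?thesis using that hom[OF subsetD[OF SS] subsetD[OF SS]] by (simp add: \<psi>)
    qed
    moreover have "\<psi> \<in> extensional ?S" by (simp add: \<psi>)
    ultimately show ?thesis
      unfolding auto_iff Q_sub_simps by (intro conjI ballI)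
  qed
  define \<psi>' where "\<psi>' = restrict (\<lambda>x. lower (\<phi> (Ext x False))) (cd_set m)"
  have \<psi>': "\<psi> (Ext x False) = Ext (\<psi>' x) False" if "x \<in> cd_set m" for x
    using map_Ext_False[OF that] that by (simp add: \<psi> \<psi>'_def)
  have \<psi>'_in: "\<psi>' x \<in> cd_set m" if "x \<in> cd_set m" for x
    using that in_set[of "Ext x False"] by (simp add: \<psi>'_def)
  have "\<psi>' \<in> auto (Q m)"
    unfolding auto_iff Q_simps
  proof (intro conjI ballI)
    show "\<psi>' \<in> extensional (cd_set m)" by (simp add: \<psi>'_def)
    have "inj_on \<psi>' (cd_set m)"
    proof (rule inj_onI)
      fix x y assume "x \<in> cd_set m" "y \<in> cd_set m" "\<psi>' x = \<psi>' y"
      then have "\<phi> (Ext x False) = \<phi> (Ext y False)"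
        using \<psi>'[of x] \<psi>'[of y] by (simp add: \<psi>)
      then show "x = y"
        using eq_iff[of "Ext x False" "Ext y False"] \<open>x \<in> cd_set m\<close> \<open>y \<in> cd_set m\<close> by simp
    qed
    then show "bij_betw \<psi>' (cd_set m) (cd_set m)"
      using \<psi>'_in finite_cd_set unfolding bij_betw_def by (metis endo_inj_surj image_subsetI)
    fix x y assume xy: "x \<in> cd_set m" "y \<in> cd_set m"
    then have "Ext (\<psi>' (x \<odot> y)) False = Ext (\<psi>' x) False \<odot> Ext (\<psi>' y) False"
      using hom[of "Ext x False" "Ext y False"] \<psi>'[of x] \<psi>'[of y] \<psi>'[of "x \<odot> y"] by (simp add: \<psi>)
    then show "\<psi>' (x \<odot> y) = \<psi>' x \<odot> \<psi>' y" by simp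
  qed
  then have 3: "\<exists>\<psi>'\<in>auto (Q m). \<forall>x\<in>cd_set m. \<psi> (Ext x False) = Ext (\<psi>' x) False"
    using \<psi>' by blast
  have e: "e = Ext (cd_one m) True"
    using assms(4) unfolding n1 Q_simps .
  obtain c where "scalar m c" "\<phi> e = Ext c True"
    using map_unit e by metis
  then have 2: "\<phi> e = e \<or> \<phi> e = cd_neg e"
    by (auto simp: e scalar_def)
  have 4: "\<phi> (Ext x True) = \<psi> (Ext x False) \<odot> \<phi> e" if "x \<in> cd_set m" for x
    using hom[of "Ext x False" e] that by (simp add: e \<psi> cd_mult_one)
  show ?thesis
    using map_one map_neg_one 2 im \<psi>_auto 3 4
    unfolding n1 unfolding n Q_simps Q_sub_simps by blast
qed

end
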